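(* Let $\alpha\in\{1/2,1\}$, let $s_n=\alpha n$ for $n\ge1$, and let $k_0\ge0$ be an integer with $k_0\le s_1$. Let $\{Z_n\}_{n\ge 1}$ be the Markov chain with $Z_1=k_0$ and, for $n\ge1$, $$\Pr(Z_{n+1}-Z_n=1\mid Z_n)=1-\frac{Z_n}{s_n},\qquad \Pr(Z_{n+1}-Z_n=0\mid Z_n)=\frac{Z_n}{s_n}.$$ Then $$\frac{Z_n}{n}\longrightarrow\frac{\alpha}{\alpha+1}\quad\text{almost surely},$$ and $$\frac{1}{\sqrt n}\left(Z_n-E[Z_n]\right)\longrightarrow N(0,\sigma^2)\quad\text{in distribution, where }\ \sigma^2=\frac{\alpha^2}{(1+\alpha)^2(2+\alpha)}.$$
   Context: In the cases considered one has $Z_n\le s_n$ for all $n$ almost surely, so the transition probabilities lie in $[0,1]$. $N(0,\sigma^2)$ is the centered normal law with variance $\sigma^2$. *)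

theory Defs
  imports "HOL-Probability.Probability"
begin

text \<open>
  A (possibly time-inhomogeneous) Markov chain indexed by \<open>n \<ge> 1\<close> on a countable state space,
  in elementary form. The library's \<^const>\<open>cond_prob\<close> is \<open>0\<close> when the conditioning event is null,
  so the Markov property is only required along histories of positive probability.
\<close>

definition markov_chain :: "'a measure \<Rightarrow> (nat \<Rightarrow> 'a \<Rightarrow> 'b::countable) \<Rightarrow> bool" where
  "markov_chain M Z \<longleftrightarrow>
     prob_space M \<and>
     (\<forall>n\<ge>1. Z n \<in> measurable M (count_space UNIV)) \<and>
     (\<forall>n\<ge>1. \<forall>x j.
        \<P>(\<omega> in M. \<forall>i\<in>{1..n}. Z i \<omega> = x i) > 0 \<longrightarrow>
        \<P>(\<omega> in M. Z (Suc n) \<omega> = j \<bar> \<forall>i\<in>{1..n}. Z i \<omega> = x i) =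
        \<P>(\<omega> in M. Z (Suc n) \<omega> = j \<bar> Z n \<omega> = x n))"

end

theory Submission
  imports Defs "HOL-Library.Discrete_Functions"
begin

text \<open>
  Write \<open>W n = Z n - \<mu> n\<close> with \<open>\<mu> = \<alpha> / (\<alpha> + 1)\<close>. Given \<open>Z n\<close>, the variable \<open>W (n + 1)\<close> is
  \<open>(1 - 1 / (\<alpha> n)) W n\<close> plus a centred Bernoulli variable of parameter \<open>1 - Z n / (\<alpha> n)\<close>. As
  \<open>\<alpha> \<ge> 1/2\<close> makes the factor a contraction, the second moment of \<open>W n\<close> is \<open>O(n)\<close>; this gives the
  strong law along the squares, and hence everywhere since the increments of \<open>W\<close> are bounded.

  For the central limit theorem, let \<open>\<psi>\<^sub>n\<close> be the characteristic function of \<open>W n\<close>. Since the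
  parameter is \<open>\<mu> - W n / (\<alpha> n)\<close>, replacing the variance of the Bernoulli variable by
  \<open>\<mu> (1 - \<mu>)\<close> shows that \<open>\<psi>\<close> satisfies the recursion of \<open>g\<^sub>n t = exp (- \<sigma>\<^sup>2 n t\<^sup>2 / 2)\<close>, namely
  \<open>g\<^sub>n\<^sub>+\<^sub>1 t = G * g\<^sub>n ((1 - 1 / (\<alpha> n)) t)\<close> with a Gaussian factor \<open>G\<close>, up to an error \<open>O(|t|\<^sup>3 + t\<^sup>2 / sqrt n)\<close>. The errors add up
  to \<open>O(|t| + n |t|\<^sup>3 + sqrt n t\<^sup>2)\<close>, which vanishes at \<open>t / sqrt n\<close>.
\<close>

section \<open>Analytic estimates\<close>

lemma iexp_quadratic_approx:
  "cmod (iexp x - (1 + \<i> * x - x\<^sup>2 / 2)) \<le> \<bar>x\<bar> ^ 3"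
proof -
  have "(\<Sum>k\<le>2. (\<i> * complex_of_real x)^k / fact k) = 1 + \<i> * x - x\<^sup>2 / 2"
    by (simp add: numeral_2_eq_2 power_mult_distrib field_simps)
  moreover have "\<bar>x\<bar> ^ 3 / 6 \<le> \<bar>x\<bar> ^ 3" by simp
  ultimately show ?thesis
    using iexp_approx1[of x 2] by (simp add: fact_numeral eval_nat_numeral)
qed

text \<open>Expand both exponentials to second order. The linear terms cancel because the variable
  is centred, the quadratic ones add up to the variance \<open>p * (1 - p)\<close>, and the two
  remainders carry weights of sum 1 and arguments of modulus at most
  \<open>\<bar>t\<bar>\<close>.\<close>

lemma centered_bernoulli_char_approx:
  fixes p t :: real
  assumes "0 \<le> p" "p \<le> 1"
  shows "cmod (p *\<^sub>R iexp (t * (1 - p)) + (1 - p) *\<^sub>R iexp (t * (- p)) - (1 - t\<^sup>2 * (p * (1 - p)) / 2)) \<le> \<bar>t\<bar> ^ 3"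
proof -
  define R where "R x = iexp x - (1 + \<i> * x - x\<^sup>2 / 2)" for x :: real
  have R: "cmod (R (t * q)) \<le> \<bar>t\<bar> ^ 3" if "\<bar>q\<bar> \<le> 1" for q
  proof -
    have "\<bar>t * q\<bar> ^ 3 \<le> \<bar>t\<bar> ^ 3"
      using that by (intro power_mono) (auto simp: abs_mult mult_left_le)
    then show ?thesis using iexp_quadratic_approx[of "t * q"] unfolding R_def by linarith
  qed
  have "p *\<^sub>R iexp (t * (1 - p)) + (1 - p) *\<^sub>R iexp (t * (- p)) - (1 - t\<^sup>2 * (p * (1 - p)) / 2)
      = p *\<^sub>R R (t * (1 - p)) + (1 - p) *\<^sub>R R (t * (- p))"
    by (simp add: R_def scaleR_conv_of_real power2_eq_square field_simps)
  also have "cmod \<dots> \<le> p * \<bar>t\<bar> ^ 3 + (1 - p) * \<bar>t\<bar> ^ 3"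
    by (intro order_trans[OF norm_triangle_ineq] add_mono)
      (use assms R[of "1 - p"] R[of "- p"] in \<open>auto intro!: mult_left_mono\<close>)
  finally show ?thesis by (simp add: algebra_simps)
qed

lemma exp_minus_linear_approx:
  fixes x y :: real
  assumes "y \<ge> 0"
  shows "\<bar>1 - x - exp (- y)\<bar> \<le> \<bar>x - y\<bar> + y\<^sup>2 / 2"
proof -
  have "1 = exp y * exp (- y)" by (simp add: exp_minus)
  also have "\<dots> \<ge> (1 + y + y\<^sup>2 / 2) * exp (- y)"
    using exp_lower_Taylor_quadratic[OF assms] by (intro mult_right_mono) auto
  finally have "(1 + y + y\<^sup>2 / 2) * exp (- y) \<le> 1" .
  \<comment> \<open>The product equals \<open>1 + y ^ 4 / 4\<close>. Cancelling the common positive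
    factor turns the quadratic lower bound for \<open>exp y\<close> into a quadratic upper bound for
    \<open>exp (- y)\<close>.\<close>
  also have "1 \<le> (1 + y + y\<^sup>2 / 2) * (1 - y + y\<^sup>2 / 2)"
    using zero_le_power[OF assms, of 4] by (simp add: field_simps power2_eq_square eval_nat_numeral)
  finally have "exp (- y) \<le> 1 - y + y\<^sup>2 / 2"
    using assms by (subst (asm) mult_le_cancel_left_pos) (auto intro!: add_pos_nonneg)
  moreover have "exp (- y) \<ge> 1 - y" using exp_ge_add_one_self[of "- y"] by simp
  ultimately show ?thesis by linarith
qed

lemma char_centered_normal:
  assumes "\<sigma> > 0"
  shows "char (density lborel (normal_density 0 \<sigma>)) t = exp (- (\<sigma>\<^sup>2 * t\<^sup>2) / 2)"
proof -
  interpret N: real_distribution std_normal_distribution by (rule real_dist_normal_dist)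
  have "distributed std_normal_distribution lborel (\<lambda>x. x) std_normal_density"
    by (auto simp: distributed_def distr_id2)
  then have "distributed std_normal_distribution lborel (\<lambda>x. \<sigma> * x) (normal_density 0 \<sigma>)"
    using assms by (subst N.normal_standard_normal_convert) auto
  then have "density lborel (normal_density 0 \<sigma>) = distr std_normal_distribution lborel (\<lambda>x. \<sigma> * x)"
    by (simp add: distributed_def)
  then have "char (density lborel (normal_density 0 \<sigma>)) t = char std_normal_distribution (t * \<sigma>)"
    by (simp add: char_def integral_distr mult.assoc)
  then show ?thesis
    by (simp add: char_std_normal_distribution power_mult_distrib mult.commute)
qed

section \<open>From the squares to all indices\<close>

lemma bounded_increments_dist:
  fixes w :: "nat \<Rightarrow> real"
  assumes step: "\<And>n. n \<ge> 1 \<Longrightarrow> \<bar>w (Suc n) - w n\<bar> \<le> 1" and "1 \<le> m" "m \<le> n"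
  shows "\<bar>w n - w m\<bar> \<le> real (n - m)"
  using \<open>m \<le> n\<close>
proof (induction n rule: dec_induct)
  case (step n)
  then show ?case using assms(1)[of n] \<open>1 \<le> m\<close> by (simp add: Suc_diff_le)
qed simp

text \<open>With \<open>q = floor_sqrt n\<close>, the index \<open>n\<close> exceeds
  \<open>q\<^sup>2\<close> by at most \<open>2 * q\<close>, so bounded increments change
  \<open>w\<close> by at most \<open>2 * q\<close> since the last square. Divided by
  \<open>n \<ge> q\<^sup>2\<close> this is at most \<open>2 / q\<close>.\<close>

lemma tendsto_of_square_subsequence:
  fixes w :: "nat \<Rightarrow> real"
  assumes step: "\<And>n. n \<ge> 1 \<Longrightarrow> \<bar>w (Suc n) - w n\<bar> \<le> 1"
    and lim: "(\<lambda>k. w (Suc k ^ 2) / real (Suc k ^ 2)) \<longlonglongrightarrow> 0"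
  shows "(\<lambda>n. w n / real n) \<longlonglongrightarrow> 0"
proof -
  \<comment> \<open>The shift matches the indexing by \<open>Suc k\<close> in the hypothesis: for
    \<open>n \<ge> 1\<close>, \<open>Suc (k n)\<close> is exactly
    \<open>floor_sqrt n\<close>.\<close>
  define k where "k n = floor_sqrt n - 1" for n
  have k: "filterlim k at_top sequentially"
    unfolding filterlim_at_top
  proof
    fix m :: nat
    show "\<forall>\<^sub>F n in sequentially. m \<le> k n"
      using eventually_ge_at_top[of "(Suc m)\<^sup>2"]
    proof eventually_elim
      case (elim n)
      then show ?case using mono_floor_sqrt'[OF elim] by (simp add: k_def)
    qed
  qed
  have "(\<lambda>n. \<bar>w (Suc (k n) ^ 2) / real (Suc (k n) ^ 2)\<bar> + 2 * (1 / real (Suc (k n)))) \<longlonglongrightarrow> 0 + 2 * 0"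
    by (intro tendsto_add tendsto_mult tendsto_const tendsto_rabs_zero
        filterlim_compose[OF lim k] filterlim_compose[OF LIMSEQ_Suc[OF lim_1_over_n] k])
  then have "(\<lambda>n. \<bar>w (Suc (k n) ^ 2) / real (Suc (k n) ^ 2)\<bar> + 2 * (1 / real (Suc (k n)))) \<longlonglongrightarrow> 0"
    by simp
  then show ?thesis
  proof (rule Lim_null_comparison[rotated])
    show "\<forall>\<^sub>F n in sequentially. norm (w n / real n)
       \<le> \<bar>w (Suc (k n) ^ 2) / real (Suc (k n) ^ 2)\<bar> + 2 * (1 / real (Suc (k n)))"
      using eventually_ge_at_top[of 1]
    proof eventually_elim
      case (elim n)
      define q where "q = floor_sqrt n"
      have q: "Suc (k n) = q" "q \<ge> 1"
        using elim floor_sqrt_greater_zero_iff[of n]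
        by (auto simp: k_def q_def simp del: floor_sqrt_greater_zero_iff)
      have le: "q\<^sup>2 \<le> n" by (simp add: q_def)
      have "n < (Suc q)\<^sup>2" unfolding q_def by (rule Suc_floor_sqrt_power2_gt)
      then have "n - q\<^sup>2 \<le> 2 * q" by (simp add: power2_eq_square)
      then have "real (n - q\<^sup>2) \<le> 2 * real q" by linarith
      moreover have "\<bar>w n - w (q\<^sup>2)\<bar> \<le> real (n - q\<^sup>2)"
        using le q by (intro bounded_increments_dist step) auto
      ultimately have "\<bar>w n\<bar> \<le> \<bar>w (q\<^sup>2)\<bar> + 2 * real q" by linarith
      then have "\<bar>w n\<bar> / real n \<le> (\<bar>w (q\<^sup>2)\<bar> + 2 * real q) / real n"
        by (intro divide_right_mono) auto
      also have "\<dots> \<le> (\<bar>w (q\<^sup>2)\<bar> + 2 * real q) / real (q\<^sup>2)"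
        using le q by (intro divide_left_mono)
          (use elim in \<open>auto intro!: mult_pos_pos simp flip: of_nat_power\<close>)
      also have "\<dots> = \<bar>w (q\<^sup>2) / real (q\<^sup>2)\<bar> + 2 * (1 / real q)"
        using q by (simp add: field_simps power2_eq_square abs_mult)
      finally show ?case by (simp add: q(1))
    qed
  qed
qed

section \<open>Gaussian approximation of a single step\<close>

definition drift :: "real \<Rightarrow> real" where
  "drift \<alpha> = \<alpha> / (\<alpha> + 1)"

text \<open>The slope \<open>drift \<alpha>\<close> is the solution \<mu> of \<mu> = 1 - \<mu> /
  \<alpha>, where the growth rate agrees with the probability of a step up. Inserting a variance
  growing like s n into the one-step recursion gives s (1 + 2 / \<alpha>) = \<mu> (1 - \<mu>) to
  leading order; \<open>limit_var \<alpha>\<close> is its solution s.\<close>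

definition limit_var :: "real \<Rightarrow> real" where
  "limit_var \<alpha> = \<alpha>\<^sup>2 / ((1 + \<alpha>)\<^sup>2 * (2 + \<alpha>))"

lemma limit_var_bounds:
  assumes "\<alpha> \<ge> 1/2"
  shows "0 < limit_var \<alpha>" "limit_var \<alpha> \<le> 1"
proof -
  show "0 < limit_var \<alpha>" using assms by (auto simp: limit_var_def)
  have "\<alpha>\<^sup>2 * 1 \<le> (1 + \<alpha>)\<^sup>2 * (2 + \<alpha>)"
    using assms by (intro mult_mono power_mono) auto
  then show "limit_var \<alpha> \<le> 1" using assms by (auto simp: limit_var_def divide_le_eq)
qed

text \<open>Here \<open>\<alpha> \<ge> 1/2\<close> matters: it gives 1 / (\<alpha> n) \<le> 2. For
  \<alpha> = 1/2 and n = 1 the factor is exactly -1.\<close>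

lemma contraction_bound:
  fixes \<alpha> :: real
  assumes "\<alpha> \<ge> 1/2" "n \<ge> 1"
  shows "\<bar>1 - 1 / (\<alpha> * real n)\<bar> \<le> 1"
proof -
  have "\<alpha> * real n \<ge> 1/2 * 1" using assms by (intro mult_mono) auto
  then show ?thesis by (auto simp: abs_le_iff field_simps)
qed

text \<open>Three errors add up: the cubic Taylor remainders, the replacement of the variance
  \<open>p * (1 - p)\<close> by its equilibrium value \<open>v\<close>, which costs the deviation of
  \<open>k\<close> divided by \<open>n\<close>, and the mismatch of order 1 / n between
  \<open>v\<close> and the variance in the Gaussian factor. That factor is chosen so that the
  Gaussian recursion is exact.\<close>

lemma step_char_approx:
  fixes \<alpha> k t :: real and n :: nat
  assumes \<alpha>: "\<alpha> \<ge> 1/2" and n: "n \<ge> 1" and t: "\<bar>t\<bar> \<le> 1" and k: "0 \<le> k" "k \<le> \<alpha> * real n"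
  defines "p \<equiv> 1 - k / (\<alpha> * real n)" and "r \<equiv> 1 - 1 / (\<alpha> * real n)"
  shows "cmod (p *\<^sub>R iexp (t * (1 - p)) + (1 - p) *\<^sub>R iexp (t * (- p))
            - exp (- (limit_var \<alpha> * (real (Suc n) - real n * r\<^sup>2) * t\<^sup>2) / 2))
       \<le> 2 * \<bar>t\<bar> ^ 3 + t\<^sup>2 * \<bar>k - drift \<alpha> * real n\<bar> / real n + 2 * t\<^sup>2 / real n"
proof -
  define v where "v = drift \<alpha> * (1 - drift \<alpha>)"
  define y where "y = limit_var \<alpha> * (real (Suc n) - real n * r\<^sup>2) * t\<^sup>2 / 2"
  define w where "w = k - drift \<alpha> * real n"
  have n': "real n \<ge> 1" and pos: "\<alpha> > 0" "\<alpha> * real n > 0" using n \<alpha> by auto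
  have p: "0 \<le> p" "p \<le> 1" using k pos by (auto simp: p_def)
  have drift: "0 \<le> drift \<alpha>" "drift \<alpha> \<le> 1" using pos by (auto simp: drift_def)
  have tt: "0 \<le> t\<^sup>2" "t\<^sup>2 \<le> 1" "t\<^sup>2 * t\<^sup>2 \<le> \<bar>t\<bar> ^ 3"
  proof -
    show "t\<^sup>2 \<le> 1" using t by (simp add: abs_square_le_1)
    have "t\<^sup>2 * t\<^sup>2 = \<bar>t\<bar> ^ 3 * \<bar>t\<bar>" by (simp add: power2_eq_square power3_eq_cube flip: abs_mult)
    also have "\<dots> \<le> \<bar>t\<bar> ^ 3" using t by (intro mult_left_le) auto
    finally show "t\<^sup>2 * t\<^sup>2 \<le> \<bar>t\<bar> ^ 3" .
  qed simp
  have pd: "p - drift \<alpha> = - (w / (\<alpha> * real n))"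
    using pos n' by (simp add: p_def w_def drift_def divide_simps) (simp add: algebra_simps)
  \<comment> \<open>Only the first factor has to be small; the second has modulus at most 1.\<close>
  have "p * (1 - p) - v = (p - drift \<alpha>) * (1 - p - drift \<alpha>)"
    by (simp add: v_def algebra_simps)
  then have "\<bar>p * (1 - p) - v\<bar> = \<bar>p - drift \<alpha>\<bar> * \<bar>1 - p - drift \<alpha>\<bar>"
    by (simp only: abs_mult)
  also have "\<dots> \<le> \<bar>p - drift \<alpha>\<bar> * 1"
    using p drift by (intro mult_left_mono) auto
  also have "\<dots> = \<bar>w\<bar> / (\<alpha> * real n)" using pos by (simp add: pd abs_mult)
  also have "\<dots> \<le> \<bar>w\<bar> / (1 / 2 * real n)"
    using \<alpha> n' pos by (intro divide_left_mono mult_right_mono) auto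
  finally have var: "\<bar>p * (1 - p) - v\<bar> \<le> 2 * \<bar>w\<bar> / real n" by (simp add: mult.commute)
  \<comment> \<open>The common factor of both variances:
    \<open>limit_var \<alpha> = \<alpha>\<^sup>2 * c\<close> and
    \<open>v = \<alpha> * (2 + \<alpha>) * c\<close>. With it, \<open>y\<close> differs from
    \<open>t\<^sup>2 * v / 2\<close> only through the term \<open>1 / real n\<close>.\<close>
  define c where "c = 1 / ((1 + \<alpha>)\<^sup>2 * (2 + \<alpha>))"
  have v: "v = \<alpha> * (2 + \<alpha>) * c"
    using pos by (simp add: v_def drift_def c_def divide_simps) (simp add: algebra_simps power2_eq_square)
  have "1 * 1 \<le> (1 + \<alpha>)\<^sup>2 * (2 + \<alpha>)"
    using pos by (intro mult_mono) auto
  then have c: "0 < c" "c \<le> 1"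
    using pos by (auto simp: c_def)
  have y1: "y = c * (\<alpha> * (2 + \<alpha>) - 1 / real n) * t\<^sup>2 / 2"
  proof -
    have "real (Suc n) - real n * r\<^sup>2 = 1 + 2 / \<alpha> - 1 / (\<alpha>\<^sup>2 * real n)"
      using pos n' by (simp add: r_def divide_simps power2_eq_square) (simp add: algebra_simps)
    moreover have "limit_var \<alpha> = \<alpha>\<^sup>2 * c" by (simp add: limit_var_def c_def)
    ultimately show ?thesis
      using pos n' by (simp add: y_def divide_simps power2_eq_square) (simp add: algebra_simps)
  qed
  \<comment> \<open>The bound \<open>\<alpha> \<ge> 1/2\<close> is used again, to keep the Gaussian
    variance nonnegative already at n = 1.\<close>
  have "1 / 2 * 2 \<le> \<alpha> * (2 + \<alpha>)" using \<alpha> by (intro mult_mono) auto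
  moreover have "1 / real n \<le> 1" using n' by simp
  ultimately have "\<alpha> * (2 + \<alpha>) - 1 / real n \<ge> 0" by linarith
  then have y0: "y \<ge> 0" using c by (simp add: y1)
  define e where "e = c * (t\<^sup>2 / real n)"
  have diff: "t\<^sup>2 * v / 2 - y = e / 2"
    by (simp add: y1 v e_def field_simps)
  have e: "0 \<le> e" "e \<le> t\<^sup>2 / real n"
    unfolding e_def using c mult_right_mono[of c 1 "t\<^sup>2 / real n"] by auto
  have y2: "\<bar>t\<^sup>2 * v / 2 - y\<bar> \<le> t\<^sup>2 / real n"
    unfolding diff using e by linarith
  have "v \<le> 1" using drift unfolding v_def by (intro mult_le_one) auto
  then have "t\<^sup>2 * v \<le> t\<^sup>2" by (simp add: mult_left_le)
  then have "y \<le> t\<^sup>2" using diff e tt by linarith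
  then have "y\<^sup>2 \<le> t\<^sup>2 * t\<^sup>2"
    using y0 unfolding power2_eq_square[of y] by (intro mult_mono) auto
  then have "y\<^sup>2 \<le> \<bar>t\<bar> ^ 3" using tt(3) by (rule order_trans)
  then have y3: "y\<^sup>2 / 2 \<le> \<bar>t\<bar> ^ 3" by (smt (verit) field_sum_of_halves zero_le_power2)
  define q where "q = p * (1 - p)"
  have "t\<^sup>2 * \<bar>q - v\<bar> \<le> t\<^sup>2 * (2 * \<bar>w\<bar> / real n)"
    using var unfolding q_def by (intro mult_left_mono) auto
  also have "\<dots> = 2 * (t\<^sup>2 * \<bar>w\<bar> / real n)" by simp
  finally have "t\<^sup>2 * \<bar>q - v\<bar> \<le> 2 * (t\<^sup>2 * \<bar>w\<bar> / real n)" .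
  moreover have "\<bar>t\<^sup>2 * q / 2 - t\<^sup>2 * v / 2\<bar> = t\<^sup>2 * \<bar>q - v\<bar> / 2"
    by (simp add: abs_mult flip: right_diff_distrib diff_divide_distrib)
  ultimately have "\<bar>t\<^sup>2 * q / 2 - t\<^sup>2 * v / 2\<bar> \<le> t\<^sup>2 * \<bar>w\<bar> / real n" by linarith
  moreover have "\<bar>1 - t\<^sup>2 * v / 2 - exp (- y)\<bar> \<le> t\<^sup>2 / real n + \<bar>t\<bar> ^ 3"
    using exp_minus_linear_approx[OF y0, of "t\<^sup>2 * v / 2"] y2 y3 by linarith
  ultimately have "\<bar>1 - t\<^sup>2 * q / 2 - exp (- y)\<bar> \<le> t\<^sup>2 * \<bar>w\<bar> / real n + t\<^sup>2 / real n + \<bar>t\<bar> ^ 3"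
    by linarith
  moreover have "t\<^sup>2 / real n \<ge> 0" by simp
  moreover define b where "b = p *\<^sub>R iexp (t * (1 - p)) + (1 - p) *\<^sub>R iexp (t * (- p))"
  moreover have "cmod (b - exp (- y)) \<le> cmod (b - (1 - t\<^sup>2 * q / 2)) + cmod (of_real (1 - t\<^sup>2 * q / 2 - exp (- y)))"
    by (rule order_trans[OF _ norm_triangle_ineq]) simp
  moreover note centered_bernoulli_char_approx[OF p, of t, folded q_def b_def]
  ultimately have "cmod (b - exp (- y)) \<le> 2 * \<bar>t\<bar> ^ 3 + t\<^sup>2 * \<bar>w\<bar> / real n + 2 * t\<^sup>2 / real n"
    unfolding norm_of_real by linarith
  then show ?thesis by (simp add: b_def y_def w_def)
qed

section \<open>The chain\<close>

locale urn_chain = prob_space M for M :: "'a measure" +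
  fixes Z :: "nat \<Rightarrow> 'a \<Rightarrow> int" and \<alpha> :: real
  assumes alpha_ge: "\<alpha> \<ge> 1/2"
    and Z_measurable [measurable]: "\<And>n. n \<ge> 1 \<Longrightarrow> Z n \<in> measurable M (count_space UNIV)"
    and up: "\<And>n k. n \<ge> 1 \<Longrightarrow> \<P>(\<omega> in M. Z n \<omega> = k) > 0 \<Longrightarrow>
           \<P>(\<omega> in M. Z (Suc n) \<omega> - Z n \<omega> = 1 \<bar> Z n \<omega> = k) = 1 - real_of_int k / (\<alpha> * real n)"
    and stay: "\<And>n k. n \<ge> 1 \<Longrightarrow> \<P>(\<omega> in M. Z n \<omega> = k) > 0 \<Longrightarrow>
           \<P>(\<omega> in M. Z (Suc n) \<omega> - Z n \<omega> = 0 \<bar> Z n \<omega> = k) = real_of_int k / (\<alpha> * real n)"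
begin

section \<open>Transition law, range and one-step expectations\<close>

lemma joint_prob:
  assumes "n \<ge> 1"
  shows "\<P>(\<omega> in M. Z (Suc n) \<omega> = k + 1 \<and> Z n \<omega> = k)
           = \<P>(\<omega> in M. Z n \<omega> = k) * (1 - real_of_int k / (\<alpha> * real n))" (is ?up)
    and "\<P>(\<omega> in M. Z (Suc n) \<omega> = k \<and> Z n \<omega> = k)
           = \<P>(\<omega> in M. Z n \<omega> = k) * (real_of_int k / (\<alpha> * real n))" (is ?stay)
proof -
  note [measurable] = Z_measurable[OF assms] Z_measurable[of "Suc n"]
  have eqs: "{\<omega> \<in> space M. Z (Suc n) \<omega> - Z n \<omega> = 1 \<and> Z n \<omega> = k} = {\<omega> \<in> space M. Z (Suc n) \<omega> = k + 1 \<and> Z n \<omega> = k}"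
    "{\<omega> \<in> space M. Z (Suc n) \<omega> - Z n \<omega> = 0 \<and> Z n \<omega> = k} = {\<omega> \<in> space M. Z (Suc n) \<omega> = k \<and> Z n \<omega> = k}"
    by auto
  have "?up \<and> ?stay"
  proof (cases "\<P>(\<omega> in M. Z n \<omega> = k) > 0")
    case True
    then show ?thesis
      using up[OF assms True] stay[OF assms True] unfolding cond_prob_def eqs
      by (simp add: divide_eq_eq mult.commute)
  next
    case False
    \<comment> \<open>For a state of probability zero the transition hypotheses say nothing, but
      both sides of the product form vanish.\<close>
    then have 0: "\<P>(\<omega> in M. Z n \<omega> = k) = 0"
      by (simp add: zero_less_measure_iff)
    have "prob {\<omega> \<in> space M. P \<omega> \<and> Z n \<omega> = k} = 0" if "{\<omega> \<in> space M. P \<omega> \<and> Z n \<omega> = k} \<in> sets M" for P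
      using finite_measure_mono[of "{\<omega> \<in> space M. P \<omega> \<and> Z n \<omega> = k}" "{\<omega> \<in> space M. Z n \<omega> = k}"] 0
      by (simp add: measure_le_0_iff subset_eq)
    then show ?thesis using 0 by simp
  qed
  then show ?up ?stay by auto
qed

text \<open>The transition probabilities force the range: \<open>k / (\<alpha> n)\<close> is a probability for every attained \<open>k\<close>.\<close>

lemma AE_range:
  assumes "n \<ge> 1"
  shows "AE \<omega> in M. 0 \<le> Z n \<omega> \<and> real_of_int (Z n \<omega>) \<le> \<alpha> * real n"
proof -
  note [measurable] = Z_measurable[OF assms]
  have pos: "\<alpha> * real n > 0" using alpha_ge assms by simp
  have "AE \<omega> in M. Z n \<omega> = k \<longrightarrow> 0 \<le> k \<and> real_of_int k \<le> \<alpha> * real n" for k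
  proof (cases "\<P>(\<omega> in M. Z n \<omega> = k) > 0")
    case True
    have nn: "\<P>(\<omega> in M. Z (Suc n) \<omega> - Z n \<omega> = j \<bar> Z n \<omega> = k) \<ge> 0" for j
      by (simp add: cond_prob_def)
    have "0 \<le> real_of_int k / (\<alpha> * real n)" "0 \<le> 1 - real_of_int k / (\<alpha> * real n)"
      using nn[of 0] nn[of 1] stay[OF assms True] up[OF assms True] by simp_all
    then show ?thesis using pos by (auto simp: zero_le_divide_iff)
  next
    case False
    then have "\<P>(\<omega> in M. Z n \<omega> = k) = 0"
      by (simp add: zero_less_measure_iff)
    then have "AE \<omega> in M. Z n \<omega> \<noteq> k"
      by (subst (asm) prob_eq_0) auto
    then show ?thesis by eventually_elim simp
  qed
  then have "AE \<omega> in M. \<forall>k. Z n \<omega> = k \<longrightarrow> 0 \<le> k \<and> real_of_int k \<le> \<alpha> * real n"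
    by (subst AE_all_countable) auto
  then show ?thesis by simp
qed

text \<open>The two transition probabilities sum to 1, so for each of the countably many states
  \<open>k\<close> the two moves exhaust the event \<open>Z n \<omega> = k\<close> up to a null
  set.\<close>

lemma AE_step:
  assumes "n \<ge> 1"
  shows "AE \<omega> in M. Z (Suc n) \<omega> = Z n \<omega> \<or> Z (Suc n) \<omega> = Z n \<omega> + 1"
proof -
  note [measurable] = Z_measurable[OF assms] Z_measurable[of "Suc n"]
  have "AE \<omega> in M. Z n \<omega> = k \<longrightarrow> Z (Suc n) \<omega> = Z n \<omega> \<or> Z (Suc n) \<omega> = Z n \<omega> + 1" for k
  proof -
    let ?A = "{\<omega> \<in> space M. Z (Suc n) \<omega> = k \<and> Z n \<omega> = k}"
    let ?B = "{\<omega> \<in> space M. Z (Suc n) \<omega> = k + 1 \<and> Z n \<omega> = k}"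
    let ?C = "{\<omega> \<in> space M. Z n \<omega> = k}"
    have "prob (?A \<union> ?B) = prob ?C"
      by (subst finite_measure_Union) (auto simp: joint_prob[OF assms], simp add: algebra_simps)
    then have "prob (?C - (?A \<union> ?B)) = 0"
      by (subst finite_measure_Diff) auto
    then have "AE \<omega> in M. \<omega> \<notin> ?C - (?A \<union> ?B)"
      by (subst (asm) prob_eq_0) auto
    then show ?thesis using AE_space by eventually_elim auto
  qed
  then have "AE \<omega> in M. \<forall>k. Z n \<omega> = k \<longrightarrow> Z (Suc n) \<omega> = Z n \<omega> \<or> Z (Suc n) \<omega> = Z n \<omega> + 1"
    by (subst AE_all_countable) auto
  then show ?thesis by simp
qed

lemma integrable_Z:
  fixes f :: "int \<Rightarrow> 'b::{banach, second_countable_topology}"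
  assumes "n \<ge> 1"
  shows "integrable M (\<lambda>\<omega>. f (Z n \<omega>))"
proof -
  note [measurable] = Z_measurable[OF assms]
  let ?S = "{0..\<lfloor>\<alpha> * real n\<rfloor>}"
  show ?thesis
  proof (rule integrable_const_bound[where B = "Max (insert 0 ((\<lambda>k. norm (f k)) ` ?S))"])
    show "AE \<omega> in M. norm (f (Z n \<omega>)) \<le> Max (insert 0 ((\<lambda>k. norm (f k)) ` ?S))"
      using AE_range[OF assms]
      by eventually_elim (intro Max_ge, auto simp: le_floor_iff)
  qed measurable
qed

text \<open>Almost surely only finitely many states occur, so conditioning on \<open>Z n\<close>
  becomes a finite sum of indicators evaluated by \<open>joint_prob\<close>. The values of
  \<open>f\<close> lie in a Banach space so that real moments and complex characteristic functions
  are both covered.\<close>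

lemma expectation_step:
  fixes f :: "int \<Rightarrow> 'b::{banach, second_countable_topology}"
  assumes "n \<ge> 1"
  defines "p \<equiv> \<lambda>k. 1 - real_of_int k / (\<alpha> * real n)"
  shows "(\<integral>\<omega>. f (Z (Suc n) \<omega>) \<partial>M)
    = (\<integral>\<omega>. p (Z n \<omega>) *\<^sub>R f (Z n \<omega> + 1) + (1 - p (Z n \<omega>)) *\<^sub>R f (Z n \<omega>) \<partial>M)"
proof -
  note [measurable] = Z_measurable[OF assms(1)] Z_measurable[of "Suc n"]
  let ?S = "{0..\<lfloor>\<alpha> * real n\<rfloor>}"
  let ?A = "\<lambda>k. {\<omega> \<in> space M. Z (Suc n) \<omega> = k \<and> Z n \<omega> = k}"
  let ?B = "\<lambda>k. {\<omega> \<in> space M. Z (Suc n) \<omega> = k + 1 \<and> Z n \<omega> = k}"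
  let ?C = "\<lambda>k. {\<omega> \<in> space M. Z n \<omega> = k}"
  have "(\<integral>\<omega>. f (Z (Suc n) \<omega>) \<partial>M)
      = (\<integral>\<omega>. (\<Sum>k\<in>?S. indicat_real (?B k) \<omega> *\<^sub>R f (k + 1) + indicat_real (?A k) \<omega> *\<^sub>R f k) \<partial>M)"
  proof (rule integral_cong_AE)
    show "AE \<omega> in M. f (Z (Suc n) \<omega>)
      = (\<Sum>k\<in>?S. indicat_real (?B k) \<omega> *\<^sub>R f (k + 1) + indicat_real (?A k) \<omega> *\<^sub>R f k)"
      using AE_range[OF assms(1)] AE_step[OF assms(1)] AE_space
    proof eventually_elim
      case (elim \<omega>)
      have "(\<Sum>k\<in>?S. indicat_real (?B k) \<omega> *\<^sub>R f (k + 1) + indicat_real (?A k) \<omega> *\<^sub>R f k)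
         = (\<Sum>k\<in>?S. if Z n \<omega> = k then f (Z (Suc n) \<omega>) else 0)"
        using elim by (intro sum.cong) (auto simp: indicator_def)
      also have "\<dots> = f (Z (Suc n) \<omega>)"
        using elim by (subst sum.delta') (auto simp: le_floor_iff)
      finally show ?case by simp
    qed
  qed measurable
  also have "\<dots> = (\<Sum>k\<in>?S. prob (?B k) *\<^sub>R f (k + 1) + prob (?A k) *\<^sub>R f k)"
    by (subst Bochner_Integration.integral_sum)
       (auto intro!: sum.cong Bochner_Integration.integrable_add integrable_scaleR_left integrable_indicator simp: less_top[symmetric])
  also have "\<dots> = (\<Sum>k\<in>?S. prob (?C k) *\<^sub>R (p k *\<^sub>R f (k + 1) + (1 - p k) *\<^sub>R f k))"
    by (intro sum.cong) (auto simp: joint_prob[OF assms(1)] p_def scaleR_add_right)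
  also have "\<dots> = (\<integral>\<omega>. (\<Sum>k\<in>?S. indicat_real (?C k) \<omega> *\<^sub>R (p k *\<^sub>R f (k + 1) + (1 - p k) *\<^sub>R f k)) \<partial>M)"
    by (subst Bochner_Integration.integral_sum)
       (auto intro!: sum.cong integrable_scaleR_left integrable_indicator simp: less_top[symmetric])
  also have "\<dots> = (\<integral>\<omega>. p (Z n \<omega>) *\<^sub>R f (Z n \<omega> + 1) + (1 - p (Z n \<omega>)) *\<^sub>R f (Z n \<omega>) \<partial>M)"
  proof (rule integral_cong_AE)
    show "AE \<omega> in M. (\<Sum>k\<in>?S. indicat_real (?C k) \<omega> *\<^sub>R (p k *\<^sub>R f (k + 1) + (1 - p k) *\<^sub>R f k))
      = p (Z n \<omega>) *\<^sub>R f (Z n \<omega> + 1) + (1 - p (Z n \<omega>)) *\<^sub>R f (Z n \<omega>)" (is "AE \<omega> in M. ?L \<omega> = ?R \<omega>")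
      using AE_range[OF assms(1)] AE_space
    proof eventually_elim
      case (elim \<omega>)
      have "?L \<omega> = (\<Sum>k\<in>?S. if Z n \<omega> = k then ?R \<omega> else 0)"
        using elim by (intro sum.cong) (auto simp: indicator_def)
      also have "\<dots> = ?R \<omega>"
        using elim by (subst sum.delta') (auto simp: le_floor_iff)
      finally show ?case .
    qed
  qed measurable
  finally show ?thesis .
qed

section \<open>Centred chain and moment bounds\<close>

definition W :: "nat \<Rightarrow> 'a \<Rightarrow> real" where
  "W n \<omega> = real_of_int (Z n \<omega>) - drift \<alpha> * real n"

definition rate :: "nat \<Rightarrow> 'a \<Rightarrow> real" where
  "rate n \<omega> = 1 - real_of_int (Z n \<omega>) / (\<alpha> * real n)"

definition contr :: "nat \<Rightarrow> real" where
  "contr n = 1 - 1 / (\<alpha> * real n)"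

lemma W_measurable [measurable]: "n \<ge> 1 \<Longrightarrow> W n \<in> borel_measurable M"
  unfolding W_def using Z_measurable[of n] by measurable

lemma AE_rate: "n \<ge> 1 \<Longrightarrow> AE \<omega> in M. 0 \<le> rate n \<omega> \<and> rate n \<omega> \<le> 1"
  using AE_range by (rule AE_mp) (use alpha_ge in \<open>auto simp: rate_def divide_le_eq\<close>)

lemma integrable_W:
  fixes f :: "real \<Rightarrow> real \<Rightarrow> 'b::{banach, second_countable_topology}"
  shows "n \<ge> 1 \<Longrightarrow> integrable M (\<lambda>\<omega>. f (W n \<omega>) (rate n \<omega>))"
  unfolding W_def rate_def by (rule integrable_Z)

text \<open>Since \<open>drift \<alpha> / \<alpha> = 1 - drift \<alpha>\<close>, staying put moves
  \<open>W n\<close> to \<open>contr n * W n - rate n\<close> with no error term, and a step up adds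
  1 to this.\<close>

lemma expectation_W_Suc:
  fixes f :: "real \<Rightarrow> 'b::{banach, second_countable_topology}"
  assumes "n \<ge> 1"
  shows "(\<integral>\<omega>. f (W (Suc n) \<omega>) \<partial>M)
    = (\<integral>\<omega>. rate n \<omega> *\<^sub>R f (contr n * W n \<omega> + (1 - rate n \<omega>))
         + (1 - rate n \<omega>) *\<^sub>R f (contr n * W n \<omega> + (- rate n \<omega>)) \<partial>M)"
proof -
  have pos: "\<alpha> > 0" "real n > 0" using alpha_ge assms by auto
  have "contr n * W n \<omega> - rate n \<omega> = real_of_int (Z n \<omega>) - drift \<alpha> * real (Suc n)" for \<omega>
    using pos by (simp add: contr_def W_def rate_def drift_def divide_simps) (simp add: algebra_simps)
  then have "contr n * W n \<omega> + (- rate n \<omega>) = real_of_int (Z n \<omega>) - drift \<alpha> * real (Suc n)"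
     "contr n * W n \<omega> + (1 - rate n \<omega>) = real_of_int (Z n \<omega> + 1) - drift \<alpha> * real (Suc n)" for \<omega>
    by (simp_all add: algebra_simps)
  then show ?thesis
    unfolding W_def[of "Suc n"]
    by (subst expectation_step[OF assms, of "\<lambda>k. f (real_of_int k - drift \<alpha> * real (Suc n))"])
       (simp only: rate_def)
qed

text \<open>The Bernoulli term has conditional mean zero, so the mean is just multiplied by
  \<open>contr n\<close>. Hence the mean of \<open>Z n\<close> stays within a bounded distance of
  \<open>drift \<alpha> * real n\<close>, which is negligible after division by sqrt n.\<close>

lemma mean_W_bound:
  assumes "n \<ge> 1"
  shows "\<bar>\<integral>\<omega>. W n \<omega> \<partial>M\<bar> \<le> \<bar>\<integral>\<omega>. W 1 \<omega> \<partial>M\<bar>"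
  using assms
proof (induction n rule: dec_induct)
  case (step n)
  have "(\<integral>\<omega>. W (Suc n) \<omega> \<partial>M) = (\<integral>\<omega>. contr n * W n \<omega> \<partial>M)"
    using step by (subst expectation_W_Suc) (auto intro!: Bochner_Integration.integral_cong simp: algebra_simps)
  then have "(\<integral>\<omega>. W (Suc n) \<omega> \<partial>M) = contr n * (\<integral>\<omega>. W n \<omega> \<partial>M)" by simp
  moreover have "\<bar>contr n\<bar> \<le> 1"
    using contraction_bound[OF alpha_ge step(1)] by (simp add: contr_def)
  ultimately have "\<bar>\<integral>\<omega>. W (Suc n) \<omega> \<partial>M\<bar> \<le> \<bar>\<integral>\<omega>. W n \<omega> \<partial>M\<bar>"
    by (simp add: abs_mult mult_left_le_one_le)
  with step show ?case by linarith
qed simp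

text \<open>The constant has to dominate both the initial second moment and the increment of at most
  1 per step; the summand 1 ensures the latter.\<close>

definition moment_const :: real where "moment_const = (\<integral>\<omega>. (W 1 \<omega>)\<^sup>2 \<partial>M) + 1"

lemma moment_const_ge_1: "moment_const \<ge> 1"
  unfolding moment_const_def by simp

text \<open>The cross term vanishes by centring, the square of \<open>contr n\<close> is at most 1,
  and the conditional variance \<open>rate n \<omega> * (1 - rate n \<omega>)\<close> is at most
  1.\<close>

lemma second_moment_W:
  assumes "n \<ge> 1"
  shows "(\<integral>\<omega>. (W n \<omega>)\<^sup>2 \<partial>M) \<le> moment_const * real n"
  using assms
proof (induction n rule: dec_induct)
  case base
  then show ?case by (simp add: moment_const_def)
next
  case (step n)
  note int [simp] = integrable_W[OF step(1), of "\<lambda>w p. w\<^sup>2"]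
  have "(\<integral>\<omega>. (W (Suc n) \<omega>)\<^sup>2 \<partial>M) = (\<integral>\<omega>. (contr n)\<^sup>2 * (W n \<omega>)\<^sup>2 + rate n \<omega> * (1 - rate n \<omega>) \<partial>M)"
    using step
    by (subst expectation_W_Suc)
       (auto intro!: Bochner_Integration.integral_cong simp: algebra_simps power2_eq_square)
  also have "\<dots> \<le> (\<integral>\<omega>. (W n \<omega>)\<^sup>2 + 1 \<partial>M)"
  proof (rule integral_mono_AE)
    have "\<bar>contr n\<bar> \<le> 1"
      using contraction_bound[OF alpha_ge step(1)] by (simp add: contr_def)
    then have "(contr n)\<^sup>2 \<le> 1" by (simp add: abs_square_le_1)
    then have le: "(contr n)\<^sup>2 * (W n \<omega>)\<^sup>2 \<le> (W n \<omega>)\<^sup>2" for \<omega> by (simp add: mult_left_le_one_le)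
    show "AE \<omega> in M. (contr n)\<^sup>2 * (W n \<omega>)\<^sup>2 + rate n \<omega> * (1 - rate n \<omega>) \<le> (W n \<omega>)\<^sup>2 + 1"
      using AE_rate[OF step(1)]
    proof eventually_elim
      case (elim \<omega>)
      then have "rate n \<omega> * (1 - rate n \<omega>) \<le> 1" by (intro mult_le_one) auto
      with le[of \<omega>] show ?case by linarith
    qed
    show "integrable M (\<lambda>\<omega>. (contr n)\<^sup>2 * (W n \<omega>)\<^sup>2 + rate n \<omega> * (1 - rate n \<omega>))"
      using step(1) by (rule integrable_W)
    show "integrable M (\<lambda>\<omega>. (W n \<omega>)\<^sup>2 + 1)" by simp
  qed
  also have "\<dots> = (\<integral>\<omega>. (W n \<omega>)\<^sup>2 \<partial>M) + 1" by (simp add: prob_space)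
  also have "\<dots> \<le> moment_const * real n + moment_const" using step moment_const_ge_1 by simp
  finally show ?case by (simp add: algebra_simps)
qed

lemma first_abs_moment_W:
  assumes "n \<ge> 1"
  shows "(\<integral>\<omega>. \<bar>W n \<omega>\<bar> \<partial>M) \<le> sqrt (moment_const * real n)"
proof -
  define s where "s = sqrt (moment_const * real n)"
  have s: "s > 0" "s\<^sup>2 = moment_const * real n" using moment_const_ge_1 assms by (auto simp: s_def)
  note [simp] = integrable_W[OF assms, of "\<lambda>w p. w\<^sup>2"] integrable_W[OF assms, of "\<lambda>w p. \<bar>w\<bar>"]
  \<comment> \<open>The arithmetic-geometric mean inequality, with the weight \<open>s\<close>
    chosen so that both terms have expectation at most \<open>s\<close>; it stands in for
    Cauchy-Schwarz.\<close>
  have "\<bar>w\<bar> \<le> (w\<^sup>2 / s + s) / 2" for w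
  proof -
    have "0 \<le> (\<bar>w\<bar> - s)\<^sup>2" by simp
    then show ?thesis using s by (simp add: field_simps power2_eq_square)
  qed
  then have "(\<integral>\<omega>. \<bar>W n \<omega>\<bar> \<partial>M) \<le> (\<integral>\<omega>. ((W n \<omega>)\<^sup>2 / s + s) / 2 \<partial>M)"
    by (intro integral_mono) auto
  also have "\<dots> = ((\<integral>\<omega>. (W n \<omega>)\<^sup>2 \<partial>M) / s + s) / 2"
    by (simp add: prob_space)
  also have "\<dots> \<le> (s\<^sup>2 / s + s) / 2"
    using second_moment_W[OF assms] s by (intro divide_right_mono add_right_mono) auto
  also have "\<dots> = s" using s(1) by (simp add: power2_eq_square)
  finally show ?thesis by (simp add: s_def)
qed

section \<open>Characteristic function of the centred chain\<close>

definition char_W :: "nat \<Rightarrow> real \<Rightarrow> complex" where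
  "char_W n t = (CLINT \<omega>|M. iexp (t * W n \<omega>))"

text \<open>Given \<open>Z n\<close>, the exponential splits into a factor of modulus 1 depending on
  \<open>contr n * W n\<close> and the Bernoulli characteristic function
  \<open>B (rate n \<omega>)\<close>. Integrating the bound of \<open>step_char_approx\<close>
  leaves the mean of \<open>\<bar>W n \<omega>\<bar>\<close> divided by n, of order 1 / sqrt
  n.\<close>

lemma char_W_step:
  assumes n: "n \<ge> 1" and t: "\<bar>t\<bar> \<le> 1"
  shows "cmod (char_W (Suc n) t
        - exp (- (limit_var \<alpha> * (real (Suc n) - real n * (contr n)\<^sup>2) * t\<^sup>2) / 2) * char_W n (contr n * t))
      \<le> (2 + sqrt moment_const) * (\<bar>t\<bar> ^ 3 + t\<^sup>2 / sqrt (real n))"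
proof -
  define G where "G = exp (- (limit_var \<alpha> * (real (Suc n) - real n * (contr n)\<^sup>2) * t\<^sup>2) / 2)"
  define B where "B p = p *\<^sub>R iexp (t * (1 - p)) + (1 - p) *\<^sub>R iexp (t * (- p))" for p
  note int = integrable_W[OF n]
  have iexp_add: "iexp (t * (contr n * w + u)) = iexp (contr n * t * w) * iexp (t * u)" for w u
    by (simp add: algebra_simps flip: exp_add)
  have "char_W (Suc n) t = (CLINT \<omega>|M. iexp (contr n * t * W n \<omega>) * B (rate n \<omega>))"
    unfolding char_W_def using n
    by (subst expectation_W_Suc[where f = "\<lambda>w. iexp (t * w)"])
       (simp_all only: iexp_add, simp only: B_def distrib_left mult_scaleR_right)
  moreover have "G * char_W n (contr n * t) = (CLINT \<omega>|M. iexp (contr n * t * W n \<omega>) * G)"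
    by (simp add: char_W_def)
  ultimately have "char_W (Suc n) t - G * char_W n (contr n * t)
      = (CLINT \<omega>|M. iexp (contr n * t * W n \<omega>) * (B (rate n \<omega>) - G))"
    using int[of "\<lambda>w p. iexp (contr n * t * w) * B p"] int[of "\<lambda>w p. iexp (contr n * t * w) * G"]
    by (simp only: right_diff_distrib Bochner_Integration.integral_diff)
  also have "cmod \<dots> \<le> (\<integral>\<omega>. cmod (iexp (contr n * t * W n \<omega>) * (B (rate n \<omega>) - G)) \<partial>M)"
    by (rule integral_norm_bound)
  also have "\<dots> \<le> (\<integral>\<omega>. 2 * \<bar>t\<bar> ^ 3 + t\<^sup>2 * \<bar>W n \<omega>\<bar> / real n + 2 * t\<^sup>2 / real n \<partial>M)"
  proof (rule integral_mono_AE)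
    show "AE \<omega> in M. cmod (iexp (contr n * t * W n \<omega>) * (B (rate n \<omega>) - G))
       \<le> 2 * \<bar>t\<bar> ^ 3 + t\<^sup>2 * \<bar>W n \<omega>\<bar> / real n + 2 * t\<^sup>2 / real n"
      using AE_range[OF n]
    proof eventually_elim
      case (elim \<omega>)
      then have "cmod (B (rate n \<omega>) - G) \<le> 2 * \<bar>t\<bar> ^ 3 + t\<^sup>2 * \<bar>W n \<omega>\<bar> / real n + 2 * t\<^sup>2 / real n"
        using step_char_approx[OF alpha_ge n t, of "real_of_int (Z n \<omega>)"]
        unfolding B_def G_def rate_def W_def contr_def by simp
      then show ?case by (simp add: norm_mult)
    qed
    show "integrable M (\<lambda>\<omega>. cmod (iexp (contr n * t * W n \<omega>) * (B (rate n \<omega>) - G)))"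
      "integrable M (\<lambda>\<omega>. 2 * \<bar>t\<bar> ^ 3 + t\<^sup>2 * \<bar>W n \<omega>\<bar> / real n + 2 * t\<^sup>2 / real n)"
      by (rule int)+
  qed
  also have "\<dots> = 2 * \<bar>t\<bar> ^ 3 + t\<^sup>2 * (\<integral>\<omega>. \<bar>W n \<omega>\<bar> \<partial>M) / real n + 2 * t\<^sup>2 / real n"
    using int[of "\<lambda>w p. \<bar>w\<bar>"] by (simp add: prob_space)
  also have "\<dots> \<le> 2 * \<bar>t\<bar> ^ 3 + t\<^sup>2 * sqrt (moment_const * real n) / real n + 2 * t\<^sup>2 / sqrt (real n)"
  proof (intro add_mono order_refl)
    show "t\<^sup>2 * (\<integral>\<omega>. \<bar>W n \<omega>\<bar> \<partial>M) / real n \<le> t\<^sup>2 * sqrt (moment_const * real n) / real n"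
      by (intro divide_right_mono mult_left_mono first_abs_moment_W n) auto
    have "sqrt (real n) \<le> real n"
      using n by (intro real_le_lsqrt) (auto simp: power2_eq_square)
    then show "2 * t\<^sup>2 / real n \<le> 2 * t\<^sup>2 / sqrt (real n)"
      using n by (intro divide_left_mono) auto
  qed
  also have "t\<^sup>2 * sqrt (moment_const * real n) / real n = sqrt moment_const * (t\<^sup>2 / sqrt (real n))"
    using n by (simp add: real_sqrt_mult field_simps)
  also have "2 * \<bar>t\<bar> ^ 3 + sqrt moment_const * (t\<^sup>2 / sqrt (real n)) + 2 * t\<^sup>2 / sqrt (real n)
      \<le> (2 + sqrt moment_const) * (\<bar>t\<bar> ^ 3 + t\<^sup>2 / sqrt (real n))"
    using moment_const_ge_1 mult_nonneg_nonneg[of "sqrt moment_const" "\<bar>t\<bar> ^ 3"]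
    by (simp add: algebra_simps add_divide_distrib)
  finally show ?thesis by (simp add: G_def)
qed

text \<open>The one-step errors accumulate without amplification, because the Gaussian factor and
  the contraction have modulus at most 1. The induction generalizes \<open>t\<close>, as its
  hypothesis is applied at \<open>r * t\<close>. The term \<open>\<bar>t\<bar>\<close> pays for the
  start, where both functions are within order \<open>\<bar>t\<bar>\<close> of 1.\<close>

lemma char_W_gaussian_approx:
  assumes "n \<ge> 1" "\<bar>t\<bar> \<le> 1"
  shows "cmod (char_W n t - exp (- (limit_var \<alpha> * real n * t\<^sup>2) / 2))
      \<le> (2 + sqrt moment_const) * (\<bar>t\<bar> + real n * \<bar>t\<bar> ^ 3 + 4 * sqrt (real n) * t\<^sup>2)"
  using assms
proof (induction n arbitrary: t rule: dec_induct)
  case base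
  let ?g = "exp (- (limit_var \<alpha> * t\<^sup>2) / 2)"
  note lv = limit_var_bounds[OF alpha_ge]
  have "char_W 1 t - 1 = (CLINT \<omega>|M. iexp (t * W 1 \<omega>) - 1)"
    using integrable_W[of 1 "\<lambda>w p. iexp (t * w)"] by (simp add: char_W_def prob_space)
  also have "cmod \<dots> \<le> (\<integral>\<omega>. cmod (iexp (t * W 1 \<omega>) - 1) \<partial>M)"
    by (rule integral_norm_bound)
  also have "\<dots> \<le> (\<integral>\<omega>. \<bar>t\<bar> * \<bar>W 1 \<omega>\<bar> \<partial>M)"
  proof (rule integral_mono)
    show "cmod (iexp (t * W 1 \<omega>) - 1) \<le> \<bar>t\<bar> * \<bar>W 1 \<omega>\<bar>" for \<omega>
      using iexp_approx1[of "t * W 1 \<omega>" 0] by (simp add: abs_mult)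
    show "integrable M (\<lambda>\<omega>. cmod (iexp (t * W 1 \<omega>) - 1))" "integrable M (\<lambda>\<omega>. \<bar>t\<bar> * \<bar>W 1 \<omega>\<bar>)"
      by (rule integrable_W[of 1], simp)+
  qed
  also have "\<dots> \<le> \<bar>t\<bar> * sqrt moment_const"
    using first_abs_moment_W[of 1] by (simp add: mult_left_mono)
  finally have 1: "cmod (char_W 1 t - 1) \<le> \<bar>t\<bar> * sqrt moment_const" .
  have "1 - limit_var \<alpha> * t\<^sup>2 / 2 \<le> ?g"
    using exp_ge_add_one_self[of "- (limit_var \<alpha> * t\<^sup>2) / 2"] by simp
  moreover have "?g \<le> 1" using lv by simp
  moreover have "limit_var \<alpha> * t\<^sup>2 \<le> 1 * \<bar>t\<bar>"
    using lv base mult_left_le[of "\<bar>t\<bar>" "\<bar>t\<bar>"] by (intro mult_mono) (auto simp: power2_eq_square)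
  ultimately have "\<bar>1 - ?g\<bar> \<le> \<bar>t\<bar>" by linarith
  moreover have "1 - complex_of_real ?g = of_real (1 - ?g)" by simp
  ultimately have "cmod (1 - complex_of_real ?g) \<le> \<bar>t\<bar>" by (simp only: norm_of_real)
  with 1 have "cmod (char_W 1 t - ?g) \<le> \<bar>t\<bar> * sqrt moment_const + \<bar>t\<bar>"
    by (intro norm_diff_triangle_le)
  also have "\<dots> \<le> (2 + sqrt moment_const) * \<bar>t\<bar>" by (simp add: algebra_simps)
  also have "\<dots> \<le> (2 + sqrt moment_const) * (\<bar>t\<bar> + real 1 * \<bar>t\<bar> ^ 3 + 4 * sqrt (real 1) * t\<^sup>2)"
    using moment_const_ge_1 by (intro mult_left_mono) auto
  finally show ?case by simp
next
  case (step n)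
  define D where "D = 2 + sqrt moment_const"
  define r where "r = contr n"
  define G where "G = exp (- (limit_var \<alpha> * (real (Suc n) - real n * r\<^sup>2) * t\<^sup>2) / 2)"
  define g where "g = exp (- (limit_var \<alpha> * real n * (r * t)\<^sup>2) / 2)"
  have D: "D > 0" using moment_const_ge_1 by (simp add: D_def add_pos_nonneg)
  have n: "n \<ge> 1" by fact
  have r1: "\<bar>r\<bar> \<le> 1"
    using contraction_bound[OF alpha_ge n] by (simp add: r_def contr_def)
  then have rt: "\<bar>r * t\<bar> \<le> \<bar>t\<bar>" by (simp add: abs_mult mult_left_le_one_le)
  \<comment> \<open>The terms with \<open>real n * r\<^sup>2\<close> cancel in the exponent: this is
    the exact Gaussian recursion.\<close>
  have Gg: "exp (- (limit_var \<alpha> * real (Suc n) * t\<^sup>2) / 2) = G * g"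
    by (simp add: G_def g_def mult_exp_exp field_simps power_mult_distrib)
  have "G \<le> 1"
  proof -
    have "real n * r\<^sup>2 \<le> real n * 1" using r1 by (intro mult_left_mono) (auto simp: abs_square_le_1)
    then show ?thesis using limit_var_bounds(1)[OF alpha_ge] by (simp add: G_def zero_le_mult_iff)
  qed
  have "cmod (char_W (Suc n) t - G * g)
      \<le> cmod (char_W (Suc n) t - G * char_W n (r * t)) + cmod (G * (char_W n (r * t) - g))"
    by (rule order_trans[OF _ norm_triangle_ineq]) (simp add: algebra_simps)
  also have "cmod (G * (char_W n (r * t) - g)) \<le> 1 * cmod (char_W n (r * t) - g)"
    unfolding norm_mult using \<open>G \<le> 1\<close> by (intro mult_right_mono) (auto simp: G_def)
  also have "1 * cmod (char_W n (r * t) - g)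
      \<le> D * (\<bar>r * t\<bar> + real n * \<bar>r * t\<bar> ^ 3 + 4 * sqrt (real n) * (r * t)\<^sup>2)"
    using step.IH[of "r * t"] rt step.prems by (simp add: g_def D_def)
  also have "\<dots> \<le> D * (\<bar>t\<bar> + real n * \<bar>t\<bar> ^ 3 + 4 * sqrt (real n) * t\<^sup>2)"
  proof -
    have "(r * t)\<^sup>2 \<le> t\<^sup>2" using rt by (simp add: abs_le_square_iff)
    moreover have "\<bar>r * t\<bar> ^ 3 \<le> \<bar>t\<bar> ^ 3" using rt by (intro power_mono) auto
    ultimately show ?thesis using D rt by (intro mult_left_mono add_mono) auto
  qed
  also have "cmod (char_W (Suc n) t - G * char_W n (r * t)) \<le> D * (\<bar>t\<bar> ^ 3 + t\<^sup>2 / sqrt (real n))"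
    using char_W_step[OF n step.prems] by (simp add: G_def r_def D_def)
  also have "D * (\<bar>t\<bar> ^ 3 + t\<^sup>2 / sqrt (real n)) + D * (\<bar>t\<bar> + real n * \<bar>t\<bar> ^ 3 + 4 * sqrt (real n) * t\<^sup>2)
     = D * (\<bar>t\<bar> + real (Suc n) * \<bar>t\<bar> ^ 3 + (4 * sqrt (real n) + 1 / sqrt (real n)) * t\<^sup>2)"
    by (simp add: algebra_simps)
  also have "\<dots> \<le> D * (\<bar>t\<bar> + real (Suc n) * \<bar>t\<bar> ^ 3 + (4 * sqrt (real (Suc n))) * t\<^sup>2)"
  proof -
    \<comment> \<open>The coefficient 4 leaves enough room for \<open>4 * sqrt (real n)\<close> to
      absorb one more summand \<open>1 / sqrt (real n)\<close> when n grows by 1.\<close>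
    have "(sqrt (real n) + 1 / (4 * sqrt (real n)))\<^sup>2 = real n + 1 / 2 + 1 / (16 * real n)"
      using n by (simp add: power2_sum power_divide power_mult_distrib)
    also have "\<dots> \<le> real (Suc n)" using n by (simp add: field_simps)
    finally have "sqrt (real n) + 1 / (4 * sqrt (real n)) \<le> sqrt (real (Suc n))"
      by (rule real_le_rsqrt)
    then have "4 * sqrt (real n) + 1 / sqrt (real n) \<le> 4 * sqrt (real (Suc n))"
      by (simp add: field_simps)
    then show ?thesis using D by (intro mult_left_mono add_left_mono mult_right_mono) auto
  qed
  finally show ?case using Gg by (simp add: D_def)
qed

lemma char_W_scaled_tendsto:
  "(\<lambda>n. char_W n (t / sqrt (real n))) \<longlonglongrightarrow> exp (- (limit_var \<alpha> * t\<^sup>2) / 2)"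
proof (rule LIM_zero_cancel, rule Lim_null_comparison)
  let ?b = "\<lambda>n. (2 + sqrt moment_const) * (\<bar>t\<bar> + \<bar>t\<bar> ^ 3 + 4 * t\<^sup>2) / sqrt (real n)"
  show "\<forall>\<^sub>F n in sequentially. cmod (char_W n (t / sqrt (real n)) - exp (- (limit_var \<alpha> * t\<^sup>2) / 2)) \<le> ?b n"
    \<comment> \<open>The threshold on n ensures that t / sqrt n lies in [-1, 1]. There each of the
      three error terms is of order 1 / sqrt n.\<close>
    using eventually_ge_at_top[of "max 1 (nat \<lceil>t\<^sup>2\<rceil>)"]
  proof eventually_elim
    case (elim n)
    then have n: "n \<ge> 1" "t\<^sup>2 \<le> real n" by linarith+
    then have "\<bar>t\<bar> \<le> sqrt (real n)" by (intro real_le_rsqrt) simp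
    then have "\<bar>t / sqrt (real n)\<bar> \<le> 1" using n by (simp add: abs_div)
    note char_W_gaussian_approx[OF n(1) this]
    also have "\<bar>t / sqrt (real n)\<bar> + real n * \<bar>t / sqrt (real n)\<bar> ^ 3 + 4 * sqrt (real n) * (t / sqrt (real n))\<^sup>2
       = (\<bar>t\<bar> + \<bar>t\<bar> ^ 3 + 4 * t\<^sup>2) / sqrt (real n)"
      using n by (simp add: power_divide power3_eq_cube field_simps)
    finally show ?case using n by (simp add: power_divide)
  qed
  show "?b \<longlonglongrightarrow> 0"
    by (intro real_tendsto_divide_at_top[OF tendsto_const] filterlim_compose[OF sqrt_at_top filterlim_real_sequentially])
qed

section \<open>The two limit theorems\<close>

lemma mean_Z: "n \<ge> 1 \<Longrightarrow> (\<integral>\<omega>. real_of_int (Z n \<omega>) \<partial>M) = (\<integral>\<omega>. W n \<omega> \<partial>M) + drift \<alpha> * real n"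
  using integrable_Z[of n real_of_int] by (simp add: W_def prob_space)

lemma central_limit:
  "weak_conv_m
     (\<lambda>n. distr M borel (\<lambda>\<omega>. 1 / sqrt (real n) *
         (real_of_int (Z n \<omega>) - (\<integral>\<omega>'. real_of_int (Z n \<omega>') \<partial>M))))
     (density lborel (normal_density 0 (sqrt (limit_var \<alpha>))))"
proof (rule levy_continuity)
  let ?X = "\<lambda>n \<omega>. 1 / sqrt (real n) * (real_of_int (Z n \<omega>) - (\<integral>\<omega>'. real_of_int (Z n \<omega>') \<partial>M))"
  have meas [measurable]: "?X n \<in> borel_measurable M" for n
    using Z_measurable[of n] by (cases "n = 0") auto
      \<comment> \<open>\<open>Z 0\<close> need not be measurable, but \<open>1 / sqrt 0 = 0\<close> removes it\<close>
  show "real_distribution (distr M borel (?X n))" for n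
    by (rule real_distribution_distr) (rule meas)
  have pos: "sqrt (limit_var \<alpha>) > 0" using limit_var_bounds(1)[OF alpha_ge] by simp
  show "real_distribution (density lborel (normal_density 0 (sqrt (limit_var \<alpha>))))"
    using prob_space_normal_density[OF pos, of 0]
    by (simp add: real_distribution_def real_distribution_axioms_def)
  fix t
  \<comment> \<open>Centring at the mean instead of \<open>drift \<alpha> * real n\<close>
    multiplies the characteristic function by the phase \<open>iexp (?u n)\<close>, which tends to 1
    by \<open>mean_W_bound\<close>.\<close>
  let ?u = "\<lambda>n. - (t / sqrt (real n) * (\<integral>\<omega>. W n \<omega> \<partial>M))"
  have "(\<lambda>n. iexp (?u n) * char_W n (t / sqrt (real n))) \<longlonglongrightarrow> iexp 0 * exp (- (limit_var \<alpha> * t\<^sup>2) / 2)"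
  proof (intro tendsto_mult char_W_scaled_tendsto tendsto_exp tendsto_of_real tendsto_const)
    show "?u \<longlonglongrightarrow> 0"
    proof (rule Lim_null_comparison)
      show "\<forall>\<^sub>F n in sequentially. norm (?u n) \<le> \<bar>t\<bar> * \<bar>\<integral>\<omega>. W 1 \<omega> \<partial>M\<bar> / sqrt (real n)"
        using eventually_ge_at_top[of 1]
        by eventually_elim (simp add: abs_mult divide_right_mono mult_left_mono mean_W_bound[unfolded One_nat_def])
      show "(\<lambda>n. \<bar>t\<bar> * \<bar>\<integral>\<omega>. W 1 \<omega> \<partial>M\<bar> / sqrt (real n)) \<longlonglongrightarrow> 0"
        by (intro real_tendsto_divide_at_top[OF tendsto_const] filterlim_compose[OF sqrt_at_top filterlim_real_sequentially])
    qed
  qed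
  moreover have "\<forall>\<^sub>F n in sequentially. iexp (?u n) * char_W n (t / sqrt (real n)) = char (distr M borel (?X n)) t"
    using eventually_ge_at_top[of 1]
  proof eventually_elim
    case (elim n)
    have eq: "t * ?X n \<omega> = ?u n + t / sqrt (real n) * W n \<omega>" for \<omega>
      unfolding mean_Z[OF elim] W_def[of n \<omega>]
      by (simp add: diff_divide_distrib add_divide_distrib algebra_simps)
    have "char (distr M borel (?X n)) t = (CLINT \<omega>|M. iexp (t * ?X n \<omega>))"
      unfolding char_def by (subst integral_distr[OF meas]) simp_all
    also have "\<dots> = (CLINT \<omega>|M. iexp (?u n) * iexp (t / sqrt (real n) * W n \<omega>))"
      unfolding eq of_real_add distrib_left exp_add ..
    finally show ?case by (simp add: char_W_def)
  qed
  ultimately show "(\<lambda>n. char (distr M borel (?X n)) t) \<longlonglongrightarrow> char (density lborel (normal_density 0 (sqrt (limit_var \<alpha>)))) t"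
    using char_centered_normal[OF pos, of t] limit_var_bounds(1)[OF alpha_ge]
    by (auto intro: Lim_transform_eventually)
qed

text \<open>The second moment of \<open>W n / real n\<close> is of order 1 / n, hence summable along
  the squares. So the sum of the \<open>?Y k\<close> has finite expectation, is finite almost
  surely, and its terms tend to 0. Since \<open>W\<close> has increments of modulus at most 1 almost
  surely, \<open>tendsto_of_square_subsequence\<close> gives all n.\<close>

lemma strong_law: "AE \<omega> in M. (\<lambda>n. real_of_int (Z n \<omega>) / real n) \<longlonglongrightarrow> drift \<alpha>"
proof -
  let ?q = "\<lambda>k. Suc k ^ 2"
  let ?Y = "\<lambda>k \<omega>. (W (?q k) \<omega> / real (?q k))\<^sup>2"
  have q: "?q k \<ge> 1" for k by simp
  note [measurable] = W_measurable[OF q]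
  have bound: "(\<integral>\<^sup>+\<omega>. ennreal (?Y k \<omega>) \<partial>M) \<le> ennreal (moment_const * inverse (real (Suc k) ^ 2))" for k
  proof -
    have "(\<integral>\<^sup>+\<omega>. ennreal (?Y k \<omega>) \<partial>M) = ennreal (\<integral>\<omega>. ?Y k \<omega> \<partial>M)"
      by (intro nn_integral_eq_integral integrable_W[OF q, of "\<lambda>w p. (w / real (?q k))\<^sup>2"]) auto
    also have "(\<integral>\<omega>. ?Y k \<omega> \<partial>M) = (\<integral>\<omega>. (W (?q k) \<omega>)\<^sup>2 \<partial>M) / (real (?q k))\<^sup>2"
      by (simp add: power_divide)
    also have "\<dots> \<le> moment_const * real (?q k) / (real (?q k))\<^sup>2"
      by (intro divide_right_mono second_moment_W q) auto
    also have "\<dots> = moment_const * inverse (real (Suc k) ^ 2)"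
      unfolding of_nat_power by (simp add: power2_eq_square divide_simps del: of_nat_Suc)
    finally show ?thesis by (simp add: ennreal_leI)
  qed
  have summable: "summable (\<lambda>k. moment_const * inverse (real (Suc k) ^ 2))"
    using inverse_power_summable[of 2, where 'a = real]
    by (intro summable_mult) (subst summable_Suc_iff[where f = "\<lambda>k. inverse (real k ^ 2)"], simp)
  have "(\<integral>\<^sup>+\<omega>. (\<Sum>k. ennreal (?Y k \<omega>)) \<partial>M) = (\<Sum>k. \<integral>\<^sup>+\<omega>. ennreal (?Y k \<omega>) \<partial>M)"
    by (rule nn_integral_suminf) measurable
  also have "\<dots> \<le> (\<Sum>k. ennreal (moment_const * inverse (real (Suc k) ^ 2)))"
    by (intro suminf_le bound) auto
  also have "\<dots> < \<infinity>"
    using moment_const_ge_1 summable by (subst suminf_ennreal2) auto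
  finally have "AE \<omega> in M. (\<Sum>k. ennreal (?Y k \<omega>)) \<noteq> \<infinity>"
    by (intro nn_integral_PInf_AE) (auto simp: less_top)
  \<comment> \<open>One null set must serve all n at once, since the interpolation between squares
    is carried out for a fixed \<omega>.\<close>
  moreover have "AE \<omega> in M. \<forall>n. n \<ge> 1 \<longrightarrow> Z (Suc n) \<omega> = Z n \<omega> \<or> Z (Suc n) \<omega> = Z n \<omega> + 1"
    unfolding AE_all_countable using AE_step by (auto intro: AE_I2)
  ultimately show ?thesis
  proof eventually_elim
    case (elim \<omega>)
    have "summable (\<lambda>k. ?Y k \<omega>)"
      using elim(1) by (intro summable_suminf_not_top) auto
    then have "(\<lambda>k. ?Y k \<omega>) \<longlonglongrightarrow> 0" by (rule summable_LIMSEQ_zero)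
    then have "(\<lambda>k. sqrt (?Y k \<omega>)) \<longlonglongrightarrow> sqrt 0" by (rule tendsto_real_sqrt)
    then have "(\<lambda>k. \<bar>W (?q k) \<omega> / real (?q k)\<bar>) \<longlonglongrightarrow> 0"
      by (simp only: real_sqrt_abs real_sqrt_zero)
    then have "(\<lambda>k. W (?q k) \<omega> / real (?q k)) \<longlonglongrightarrow> 0"
      by (rule tendsto_rabs_zero_cancel)
    moreover have "\<bar>W (Suc n) \<omega> - W n \<omega>\<bar> \<le> 1" if "n \<ge> 1" for n
    proof -
      have "0 \<le> drift \<alpha>" "drift \<alpha> \<le> 1" using alpha_ge by (auto simp: drift_def)
      moreover have "W (Suc n) \<omega> - W n \<omega> = real_of_int (Z (Suc n) \<omega> - Z n \<omega>) - drift \<alpha>"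
        by (simp add: W_def algebra_simps)
      ultimately show ?thesis using elim(2) that by auto
    qed
    ultimately have "(\<lambda>n. W n \<omega> / real n) \<longlonglongrightarrow> 0"
      by (intro tendsto_of_square_subsequence)
    then have "(\<lambda>n. W n \<omega> / real n + drift \<alpha>) \<longlonglongrightarrow> 0 + drift \<alpha>"
      by (intro tendsto_add tendsto_const)
    moreover have "\<forall>\<^sub>F n in sequentially. W n \<omega> / real n + drift \<alpha> = real_of_int (Z n \<omega>) / real n"
      using eventually_ge_at_top[of 1] by eventually_elim (simp add: W_def field_simps)
    ultimately show ?case by (auto intro: Lim_transform_eventually)
  qed
qed

end

theorem mainTheorem5:
  fixes M :: "'a measure"
    and Z :: "nat \<Rightarrow> 'a \<Rightarrow> int"
    and \<alpha> :: real
    and s :: "nat \<Rightarrow> real"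
    and k0 :: int
  assumes "\<alpha> \<in> {1/2, 1}"
    and "\<And>n. n \<ge> 1 \<Longrightarrow> s n = \<alpha> * real n"
    and "0 \<le> k0"
    and "real_of_int k0 \<le> s 1"
    and "markov_chain M Z"
    and "AE \<omega> in M. Z 1 \<omega> = k0"
    and "\<And>n k. n \<ge> 1 \<Longrightarrow> \<P>(\<omega> in M. Z n \<omega> = k) > 0 \<Longrightarrow>
           \<P>(\<omega> in M. Z (Suc n) \<omega> - Z n \<omega> = 1 \<bar> Z n \<omega> = k) = 1 - real_of_int k / s n"
    and "\<And>n k. n \<ge> 1 \<Longrightarrow> \<P>(\<omega> in M. Z n \<omega> = k) > 0 \<Longrightarrow>
           \<P>(\<omega> in M. Z (Suc n) \<omega> - Z n \<omega> = 0 \<bar> Z n \<omega> = k) = real_of_int k / s n"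
  shows "(AE \<omega> in M. (\<lambda>n. real_of_int (Z n \<omega>) / real n) \<longlonglongrightarrow> \<alpha> / (\<alpha> + 1)) \<and>
    weak_conv_m
      (\<lambda>n. distr M borel (\<lambda>\<omega>. 1 / sqrt (real n) *
         (real_of_int (Z n \<omega>) - (\<integral>\<omega>'. real_of_int (Z n \<omega>') \<partial>M))))
      (density lborel (normal_density 0 (sqrt (\<alpha>^2 / ((1 + \<alpha>)^2 * (2 + \<alpha>))))))"
proof -
  interpret prob_space M using assms(5) by (simp add: markov_chain_def)
  interpret urn_chain M Z \<alpha>
  proof
    show "\<alpha> \<ge> 1/2" using assms(1) by auto
    show "Z n \<in> measurable M (count_space UNIV)" if "n \<ge> 1" for n
      using assms(5) that by (simp add: markov_chain_def)
  qed (simp_all only: assms(7,8) assms(2)[symmetric])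
  show ?thesis using strong_law central_limit by (simp add: drift_def limit_var_def)
qed

end
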